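(* Let $X$ be a metric space and let $f_n \colon (2^\omega)^\omega \to X$ ($n \in \omega$) be $(v^\omega)$-measurable functions. Then there exists a Silver cube $Q = \prod_{m \in \omega} Q_m$ such that each $f_n|_Q$ is continuous.
   Context: For $D \subseteq \omega$ and $h \colon D \to 2$ put $[h] = \{x \in 2^\omega : \forall n \in D,\ x(n) = h(n)\}$. A Silver cube is a set $\prod_{m \in \omega} [h_m] \subseteq (2^\omega)^\omega$ where each $h_m \in 2^{D_m}$ and each $D_m \subseteq \omega$ is coinfinite (i.e. $\omega\setminus D_m$ is infinite). A set $A \subseteq (2^\omega)^\omega$ has the $(v^\omega)$-property (written $A \in v^\omega$) if for every Silver cube $P$ there is a Silver cube $Q \subseteq P$ such that $Q \subseteq A$ or $Q \subseteq (2^\omega)^\omega \setminus A$. A function $f \colon (2^\omega)^\omega \to X$ into a metric space is $(v^\omega)$-measurable if $f^{-1}(U) \in v^\omega$ for every open $U \subseteq X$. Continuity refers to the subspace topology inherited from the product topology. *)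

theory Defs
  imports "HOL-Analysis.Analysis"
begin

text \<open>
  Points of the Cantor space are functions \<open>nat \<Rightarrow> bool\<close>; points of its countable power are functions
  \<open>nat \<Rightarrow> nat \<Rightarrow> bool\<close>. The topology on both function types is the library's
  product topology; the linear-order topology of \<open>bool\<close> is the discrete one.

  A function \<open>h : D \<rightarrow> 2\<close> with \<open>D \<subseteq> \<omega>\<close> is a partial map \<open>h\<close> with \<open>D = dom h\<close>.
\<close>

definition extensions :: "(nat \<rightharpoonup> bool) \<Rightarrow> (nat \<Rightarrow> bool) set" where
  "extensions h = {x. \<forall>n\<in>dom h. h n = Some (x n)}"

definition silver_cube :: "(nat \<Rightarrow> nat \<Rightarrow> bool) set \<Rightarrow> bool" where
  "silver_cube P \<longleftrightarrow>
    (\<exists>h :: nat \<Rightarrow> nat \<rightharpoonup> bool. (\<forall>m. infinite (- dom (h m))) \<and> P = (\<Pi> m\<in>UNIV. extensions (h m)))"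

definition v_omega :: "(nat \<Rightarrow> nat \<Rightarrow> bool) set set" where
  "v_omega =
    {A. \<forall>P. silver_cube P \<longrightarrow> (\<exists>Q. silver_cube Q \<and> Q \<subseteq> P \<and> (Q \<subseteq> A \<or> Q \<subseteq> - A))}"

definition v_omega_measurable :: "((nat \<Rightarrow> nat \<Rightarrow> bool) \<Rightarrow> 'a::metric_space) \<Rightarrow> bool" where
  "v_omega_measurable f \<longleftrightarrow> (\<forall>U. open U \<longrightarrow> f -` U \<in> v_omega)"

end

theory Submission
  imports Defs
begin

text \<open>
  If \<open>X\<close> is separable, a fusion argument suffices: a countable base gives countably many
  preimages, and one can shrink to a Silver cube on which each of them is decided by finitely many
  coordinates. For a general metric space the base is uncountable, and the work lies in reaching
  the following statement without separability: for each \<open>\<epsilon> > 0\<close>, every Silver cube \<open>P\<close> contains a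
  Silver cube whose image under a given measurable map \<open>f\<close> lies in a ball of radius \<open>\<epsilon>\<close>
  (\<open>small_image_on_subcube\<close>). Given this, \<open>fusion\<close> applied to all pairs of a function \<open>f n\<close> and a
  radius \<open>1 / (j + 1)\<close> produces a cube that, for each such pair, is divided by finitely many
  coordinates into relatively open pieces on which \<open>f n\<close> varies by less than \<open>2 / (j + 1)\<close>; hence continuity.

  To find small images, cover \<open>X\<close> by countably many disjoint families of small open sets
  (\<open>sigma_disjoint_open_cover\<close>). By fusion, one of these families covers the image of a subcube.
  On that subcube let \<open>g\<close> map a point to the index of the member that contains its image.
  Unions of members are open, so the preimage of every set of indices whatsoever is decided by
  subcubes, and it remains to show that such a \<open>g\<close> is constant on some subcube
  (\<open>constant_on_subcube\<close>).

  Suppose it is not. Then each subcube contains two subcubes with disjoint images: if it did not,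
  each set of indices would be decided in the same way by all those of its subcubes that decide it; the values of \<open>g\<close>
  can be told apart by countably many sets, because there are at most continuum many of them;
  and fusing over these sets would make \<open>g\<close> constant (\<open>split_or_constant\<close>). Iterating the
  splitting, \<open>g\<close> takes continuum many values on each subcube (\<open>continuum_many_values\<close>). Since
  there are only continuum many cubes, a Bernstein construction (\<open>injective_choice\<close>) yields a set
  of indices that meets the image of each subcube without containing it. Its preimage is not
  decided by any subcube, a contradiction.
\<close>

section \<open>Cubes given by their free coordinates\<close>

text \<open>
  A Silver cube is given by the set \<open>D\<close> of its free coordinates, over all columns at once, and any
  one of its points. Pieces cut out by finitely many coordinates are then simply \<open>cube (D - F) y\<close>.
\<close>

definition cube :: "(nat \<times> nat) set \<Rightarrow> (nat \<Rightarrow> nat \<Rightarrow> bool) \<Rightarrow> (nat \<Rightarrow> nat \<Rightarrow> bool) set" where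
  "cube D x = {y. \<forall>m n. (m, n) \<notin> D \<longrightarrow> y m n = x m n}"

definition wide :: "(nat \<times> nat) set \<Rightarrow> bool" where
  "wide D \<longleftrightarrow> (\<forall>m. infinite {n. (m, n) \<in> D})"

lemma silver_cube_iff: "silver_cube P \<longleftrightarrow> (\<exists>D x. wide D \<and> P = cube D x)"
proof
  assume "silver_cube P"
  then obtain h :: "nat \<Rightarrow> nat \<rightharpoonup> bool" where
    h: "\<And>m. infinite (- dom (h m))" and P: "P = (\<Pi> m\<in>UNIV. extensions (h m))"
    unfolding silver_cube_def by blast
  define D where "D = {(m, n). n \<notin> dom (h m)}"
  have "{n. (m, n) \<in> D} = - dom (h m)" for m
    by (auto simp: D_def)
  then have "wide D"
    using h by (simp add: wide_def)
  moreover have "P = cube D (\<lambda>m n. the (h m n))"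
    unfolding P cube_def extensions_def D_def Pi_def
  proof (intro Collect_cong)
    fix y
    have "(\<forall>n\<in>dom (h m). h m n = Some (y m n)) \<longleftrightarrow> (\<forall>n. n \<in> dom (h m) \<longrightarrow> y m n = the (h m n))" for m
      by (auto simp: dom_def)
    then show "(\<forall>m. m \<in> UNIV \<longrightarrow> y m \<in> {x. \<forall>n\<in>dom (h m). h m n = Some (x n)}) \<longleftrightarrow>
        (\<forall>m n. (m, n) \<notin> {(m, n). n \<notin> dom (h m)} \<longrightarrow> y m n = the (h m n))"
      by simp
  qed
  ultimately show "\<exists>D x. wide D \<and> P = cube D x" by blast
next
  assume "\<exists>D x. wide D \<and> P = cube D x"
  then obtain D x where D: "wide D" and P: "P = cube D x" by blast
  define h where "h = (\<lambda>m n. if (m, n) \<in> D then None else Some (x m n))"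
  have dom: "- dom (h m) = {n. (m, n) \<in> D}" for m
    by (auto simp: h_def dom_def)
  have "P = (\<Pi> m\<in>UNIV. extensions (h m))"
    unfolding P cube_def extensions_def by (auto simp: Pi_def h_def dom_def split: if_splits)
  then show "silver_cube P"
    unfolding silver_cube_def using D dom by (intro exI[of _ h]) (simp add: wide_def)
qed

lemma silver_cube_cube: "wide D \<Longrightarrow> silver_cube (cube D x)"
  unfolding silver_cube_iff by blast

lemma self_in_cube [simp]: "x \<in> cube D x"
  by (simp add: cube_def)

lemma cube_eq: "y \<in> cube D x \<Longrightarrow> cube D y = cube D x"
  by (simp add: cube_def)

lemma cube_mono: "D' \<subseteq> D \<Longrightarrow> x' \<in> cube D x \<Longrightarrow> cube D' x' \<subseteq> cube D x"
  unfolding cube_def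
proof (intro subsetI CollectI allI impI)
  fix y m n
  assume "D' \<subseteq> D" "x' \<in> {y. \<forall>m n. (m, n) \<notin> D \<longrightarrow> y m n = x m n}"
    "y \<in> {y. \<forall>m n. (m, n) \<notin> D' \<longrightarrow> y m n = x' m n}" "(m, n) \<notin> D"
  then have "y m n = x' m n" "x' m n = x m n"
    by blast+
  then show "y m n = x m n"
    by (rule trans)
qed

lemma cube_subsetD:
  assumes "cube D' x' \<subseteq> cube D x"
  shows "D' \<subseteq> D"
proof
  fix p assume p: "p \<in> D'"
  obtain m n where mn: "p = (m, n)" by fastforce
  \<comment> \<open>Otherwise flipping the value at \<open>p\<close> leads out of the larger cube.\<close>
  define y where "y = x'(m := (x' m)(n := \<not> x' m n))"
  have "y \<in> cube D' x'"
    using p mn by (auto simp: cube_def y_def)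
  then have "y \<in> cube D x" "x' \<in> cube D x"
    using assms by auto
  then show "p \<in> D"
    unfolding mn cube_def y_def by fastforce
qed

lemma wide_mono: "wide D \<Longrightarrow> D \<subseteq> E \<Longrightarrow> wide E"
  unfolding wide_def
proof
  fix m assume "\<forall>m. infinite {n. (m, n) \<in> D}" "D \<subseteq> E"
  moreover then have "{n. (m, n) \<in> D} \<subseteq> {n. (m, n) \<in> E}"
    by blast
  ultimately show "infinite {n. (m, n) \<in> E}"
    using finite_subset by blast
qed

lemma wide_diff_finite:
  assumes "wide D" "finite F"
  shows "wide (D - F)"
  unfolding wide_def
proof
  fix m
  have "finite {n. (m, n) \<in> F}"
    using assms(2) finite_vimageI[of F "Pair m"] by (simp add: vimage_def inj_on_def)
  moreover have "{n. (m, n) \<in> D - F} = {n. (m, n) \<in> D} - {n. (m, n) \<in> F}"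
    by auto
  ultimately show "infinite {n. (m, n) \<in> D - F}"
    using assms(1) by (simp add: wide_def)
qed

text \<open>
  Once a coordinate ceases to be free its value never changes again, so the first stage at
  which this happens determines the value of a common point.
\<close>

lemma nested_cubes_common_point:
  assumes D: "\<And>k. D (Suc k) \<subseteq> D k"
    and x: "\<And>k. x (Suc k) \<in> cube (D k) (x k)"
  obtains z where "\<And>k. z \<in> cube (D k) (x k)"
proof -
  have Dmono: "D l \<subseteq> D k" if "k \<le> l" for k l
    using lift_Suc_antimono_le[of D] D that by blast
  have stable: "x l m n = x k m n" if "k \<le> l" "(m, n) \<notin> D k" for k l m n
    using that(1)
  proof (induction l rule: dec_induct)
    case (step l)
    then have "(m, n) \<notin> D l"
      using Dmono that(2) by blast
    then show ?case
      using x[of l] step.IH by (simp add: cube_def)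
  qed simp
  define z where "z = (\<lambda>m n. x (LEAST k. (m, n) \<notin> D k) m n)"
  have "z \<in> cube (D k) (x k)" for k
    unfolding cube_def
  proof (intro CollectI allI impI)
    fix m n assume mn: "(m, n) \<notin> D k"
    have "(LEAST k. (m, n) \<notin> D k) \<le> k" "(m, n) \<notin> D (LEAST k. (m, n) \<notin> D k)"
      using Least_le[of "\<lambda>k. (m, n) \<notin> D k"] LeastI[of "\<lambda>k. (m, n) \<notin> D k"] mn by auto
    from stable[OF this] show "z m n = x k m n"
      by (simp add: z_def)
  qed
  then show thesis using that by blast
qed


section \<open>Fusion\<close>

text \<open>
  One step of the fusion. The assignments of values to the coordinates in \<open>F\<close> are treated one
  after another: the piece of the cube that belongs to an assignment is shrunk into \<open>R\<close>, and
  all the other pieces are shrunk in the same way, which does not harm them because \<open>R\<close>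
  is inherited by subsets.
\<close>

lemma amalgamation:
  assumes anti: "\<And>S T. R T \<Longrightarrow> S \<subseteq> T \<Longrightarrow> R S"
    and dense: "\<And>Q. silver_cube Q \<Longrightarrow> Q \<subseteq> cube D x \<Longrightarrow> \<exists>Q'. silver_cube Q' \<and> Q' \<subseteq> Q \<and> R Q'"
    and wide: "wide D" and F: "finite F" "F \<subseteq> D"
  obtains D' x' where "wide D'" "F \<subseteq> D'" "D' \<subseteq> D" "x' \<in> cube D x"
    "\<And>y. y \<in> cube D' x' \<Longrightarrow> R (cube (D' - F) y)"
proof -
  have step: "\<exists>D' x'. wide D' \<and> F \<subseteq> D' \<and> D' \<subseteq> D \<and> x' \<in> cube D x \<and>
      (\<forall>y\<in>cube D' x'. {(m, n)\<in>F. y m n} \<in> T \<longrightarrow> R (cube (D' - F) y))" if "finite T" for T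
    using that
  proof (induction T rule: finite_induct)
    case empty
    then show ?case using wide F(2) by (intro exI[of _ D] exI[of _ x]) auto
  next
    case (insert t T)
    then obtain D' x' where D': "wide D'" "F \<subseteq> D'" "D' \<subseteq> D" and x': "x' \<in> cube D x"
      and R: "\<And>y. y \<in> cube D' x' \<Longrightarrow> {(m, n)\<in>F. y m n} \<in> T \<Longrightarrow> R (cube (D' - F) y)"
      by blast
    define z where "z = (\<lambda>m n. if (m, n) \<in> F then (m, n) \<in> t else x' m n)"
    have z: "z \<in> cube D' x'"
      using D'(2) by (auto simp: z_def cube_def)
    have sub: "cube D' x' \<subseteq> cube D x"
      using D'(3) x' by (rule cube_mono)
    have sub2: "cube (D' - F) z \<subseteq> cube D' x'"
      using z by (intro cube_mono) auto
    obtain E w where E: "wide E" and w: "cube E w \<subseteq> cube (D' - F) z" and RE: "R (cube E w)"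
      using dense[of "cube (D' - F) z"] silver_cube_cube[OF wide_diff_finite[OF D'(1) F(1)]]
        sub sub2 unfolding silver_cube_iff by blast
    have ED: "E \<subseteq> D' - F"
      using w by (rule cube_subsetD)
    have w': "w \<in> cube (D' - F) z"
      using w by auto
    have EF: "E \<union> F - F = E"
      using ED by auto
    have sub3: "cube (E \<union> F) w \<subseteq> cube D' x'"
      using ED D'(2) w' sub2 by (intro cube_mono) auto
    have "R (cube (E \<union> F - F) y)"
      if y: "y \<in> cube (E \<union> F) w" and yt: "{(m, n)\<in>F. y m n} \<in> insert t T" for y
    proof (cases "{(m, n)\<in>F. y m n} = t")
      case True
      have "y m n = w m n" if "(m, n) \<notin> E" for m n
      proof (cases "(m, n) \<in> F")
        case mnF: True
        then have "w m n = z m n"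
          using w' by (auto simp: cube_def)
        then show ?thesis
          using mnF True by (auto simp: z_def)
      qed (use y that in \<open>auto simp: cube_def\<close>)
      then have "y \<in> cube E w"
        by (simp add: cube_def)
      then show ?thesis
        using RE EF cube_eq by metis
    next
      case False
      then have "R (cube (D' - F) y)"
        using R y yt sub3 by blast
      then show ?thesis
        using anti cube_mono[of E "D' - F" y y] ED EF by simp
    qed
    then show ?case
      using E D' ED x' sub sub2 w' wide_mono[of E "E \<union> F"]
      by (intro exI[of _ "E \<union> F"] exI[of _ w]) blast
  qed
  have "finite (Pow F)"
    using F(1) by simp
  from step[OF this] obtain D' x' where *: "wide D'" "F \<subseteq> D'" "D' \<subseteq> D" "x' \<in> cube D x"
      "\<forall>y\<in>cube D' x'. {(m, n)\<in>F. y m n} \<in> Pow F \<longrightarrow> R (cube (D' - F) y)"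
    by blast
  have "{(m, n)\<in>F. y m n} \<in> Pow F" for y
    by auto
  then have "R (cube (D' - F) y)" if "y \<in> cube D' x'" for y
    using *(5) that by blast
  with *(1-4) show thesis
    by (rule that)
qed

text \<open>
  Stage \<open>k\<close> applies \<open>amalgamation\<close> to \<open>R k\<close> and promises finitely many coordinates to stay free
  from then on. The promised sets grow so that every column receives arbitrarily large free
  coordinates, which makes the limit cube wide; the property obtained at stage \<open>k\<close> passes to
  the pieces of the limit because it is inherited by subsets.
\<close>

lemma fusion:
  fixes R :: "nat \<Rightarrow> (nat \<Rightarrow> nat \<Rightarrow> bool) set \<Rightarrow> bool"
  assumes anti: "\<And>k S T. R k T \<Longrightarrow> S \<subseteq> T \<Longrightarrow> R k S"
    and dense: "\<And>k Q. silver_cube Q \<Longrightarrow> Q \<subseteq> P \<Longrightarrow> \<exists>Q'. silver_cube Q' \<and> Q' \<subseteq> Q \<and> R k Q'"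
    and P: "silver_cube P"
  obtains D x where "wide D" "cube D x \<subseteq> P"
    "\<And>k. \<exists>F. finite F \<and> (\<forall>y\<in>cube D x. R k (cube (D - F) y))"
proof -
  define good where "good = (\<lambda>k (D, x, F). wide D \<and> finite F \<and> F \<subseteq> D \<and> cube D x \<subseteq> P \<and>
    (\<forall>y\<in>cube D x. R k (cube (D - F) y)))"
  define next_stage :: "nat \<Rightarrow> (nat \<times> nat) set \<times> (nat \<Rightarrow> nat \<Rightarrow> bool) \<times> (nat \<times> nat) set \<Rightarrow>
      (nat \<times> nat) set \<times> (nat \<Rightarrow> nat \<Rightarrow> bool) \<times> (nat \<times> nat) set \<Rightarrow> bool" where
    "next_stage = (\<lambda>k (D, x, F) (D', x', F'). F \<subseteq> F' \<and> D' \<subseteq> D \<and> x' \<in> cube D x \<and>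
      (\<forall>m\<le>k. \<exists>n\<ge>k. (m, n) \<in> F'))"
  obtain D0 x0 where P0: "wide D0" "P = cube D0 x0"
    using P unfolding silver_cube_iff by blast
  have "\<exists>s. \<forall>k. good k (s k) \<and> next_stage k (s k) (s (Suc k))"
  proof (rule dependent_nat_choice)
    obtain Q where "silver_cube Q" "Q \<subseteq> P" "R 0 Q"
      using dense[OF P] by blast
    moreover then obtain D x where "wide D" "Q = cube D x"
      unfolding silver_cube_iff by blast
    ultimately have "good 0 (D, x, {})"
      unfolding good_def by (auto simp: cube_eq)
    then show "\<exists>s. good 0 s" by blast
  next
    fix s k assume "good k s"
    then obtain D x F where s: "s = (D, x, F)" and D: "wide D" "finite F" "F \<subseteq> D" "cube D x \<subseteq> P"
      unfolding good_def by (cases s) auto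
    have "\<exists>n\<ge>k. (m, n) \<in> D" for m
      using D(1) unfolding wide_def infinite_nat_iff_unbounded_le by auto
    then obtain c where c: "\<And>m. c m \<ge> k" "\<And>m. (m, c m) \<in> D"
      by metis
    define F' where "F' = F \<union> (\<lambda>m. (m, c m)) ` {..k}"
    have F': "finite F'" "F' \<subseteq> D"
      using D c by (auto simp: F'_def)
    obtain D' x' where "wide D'" "F' \<subseteq> D'" "D' \<subseteq> D" "x' \<in> cube D x"
        "\<And>y. y \<in> cube D' x' \<Longrightarrow> R (Suc k) (cube (D' - F') y)"
    proof (rule amalgamation[of "R (Suc k)" D x F'])
      show "\<exists>Q'. silver_cube Q' \<and> Q' \<subseteq> Q \<and> R (Suc k) Q'"
        if "silver_cube Q" "Q \<subseteq> cube D x" for Q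
        using dense[OF that(1)] that(2) D(4) by blast
    qed (use anti D(1) F' in blast)+
    then have "good (Suc k) (D', x', F')"
      unfolding good_def using F'(1) cube_mono[of D' D x' x] D(4) by simp
    moreover have "\<exists>n\<ge>k. (m, n) \<in> F'" if "m \<le> k" for m
      using c(1) that by (auto simp: F'_def)
    then have "next_stage k s (D', x', F')"
      unfolding next_stage_def s using \<open>D' \<subseteq> D\<close> \<open>x' \<in> cube D x\<close> by (simp add: F'_def)
    ultimately show "\<exists>s'. good (Suc k) s' \<and> next_stage k s s'" by blast
  qed
  then obtain s where s: "\<And>k. good k (s k)" "\<And>k. next_stage k (s k) (s (Suc k))"
    by blast
  define D where "D = (\<lambda>k. fst (s k))"
  define x where "x = (\<lambda>k. fst (snd (s k)))"
  define F where "F = (\<lambda>k. snd (snd (s k)))"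
  have seq: "s k = (D k, x k, F k)" for k
    by (simp add: D_def x_def F_def)
  have g: "finite (F k)" "F k \<subseteq> D k" "cube (D k) (x k) \<subseteq> P"
      "\<And>y. y \<in> cube (D k) (x k) \<Longrightarrow> R k (cube (D k - F k) y)" for k
    using s(1)[of k] unfolding seq good_def by auto
  have st: "F k \<subseteq> F (Suc k)" "D (Suc k) \<subseteq> D k" "x (Suc k) \<in> cube (D k) (x k)"
      "\<And>m. m \<le> k \<Longrightarrow> \<exists>n\<ge>k. (m, n) \<in> F (Suc k)" for k
    using s(2)[of k] unfolding seq next_stage_def by auto
  obtain z where z: "\<And>k. z \<in> cube (D k) (x k)"
    using nested_cubes_common_point[of D x] st by blast
  \<comment> \<open>The values of \<open>x k\<close> need not converge on coordinates that are free at all stages, so these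
    are kept free in the limit even if they were never promised.\<close>
  define E where "E = (\<Inter>k. D k)"
  have FE: "F k \<subseteq> E" for k
  proof -
    have "F k \<subseteq> D l" for l
    proof (cases "k \<le> l")
      case True
      then have "F k \<subseteq> F l"
        using lift_Suc_mono_le[of F k l] st(1) by blast
      then show ?thesis using g(2) by blast
    next
      case False
      then have "D k \<subseteq> D l"
        using lift_Suc_antimono_le[of D l k] st(2) by simp
      then show ?thesis using g(2) by blast
    qed
    then show ?thesis by (auto simp: E_def)
  qed
  have sub: "cube E z \<subseteq> cube (D k) (x k)" for k
    using z by (intro cube_mono) (auto simp: E_def)
  show thesis
  proof (rule that)
    show "wide E"
      unfolding wide_def infinite_nat_iff_unbounded_le
    proof (intro allI)
      fix m i
      have "\<exists>n\<ge>max m i. (m, n) \<in> F (Suc (max m i))"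
        by (rule st(4)) simp
      then show "\<exists>n\<ge>i. n \<in> {n. (m, n) \<in> E}"
        using FE by fastforce
    qed
    show "cube E z \<subseteq> P"
      using sub g(3) by blast
    show "\<exists>F. finite F \<and> (\<forall>y\<in>cube E z. R k (cube (E - F) y))" for k
    proof (intro exI conjI ballI)
      show "finite (F k)" by (rule g(1))
      fix y assume "y \<in> cube E z"
      then have "R k (cube (D k - F k) y)"
        using g(4) sub by blast
      moreover have "cube (E - F k) y \<subseteq> cube (D k - F k) y"
        by (rule cube_mono) (auto simp: E_def)
      ultimately show "R k (cube (E - F k) y)"
        using anti by blast
    qed
  qed
qed


section \<open>Maps all of whose fibre unions are decided\<close>

text \<open>
  Transfinite recursion along a well-order of \<open>K\<close> of minimal length: the values chosen at earlier
  indices are fewer than the elements of \<open>S k\<close>, so an unused element remains.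
\<close>

lemma injective_choice:
  fixes S :: "'k \<Rightarrow> 'b set"
  assumes "\<And>k. k \<in> K \<Longrightarrow> \<exists>i. inj_on i K \<and> i ` K \<subseteq> S k"
  obtains e where "inj_on e K" "\<And>k. k \<in> K \<Longrightarrow> e k \<in> S k"
proof -
  define r where "r = card_of K"
  have r: "Card_order r" "Field r = K" "well_order_on K r"
    unfolding r_def using card_of_Card_order[of K] card_of_well_order_on[of K] by (simp_all add: Field_card_of)
  have fresh: "S k - e ` underS r k \<noteq> {}" if k: "k \<in> K" for k and e :: "'k \<Rightarrow> 'b"
  proof
    assume "S k - e ` underS r k = {}"
    then have "S k \<subseteq> e ` underS r k" by blast
    moreover have "(card_of K, card_of (S k)) \<in> ordLeq"
      using assms[OF k] card_of_ordLeq by blast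
    ultimately have "(card_of K, card_of (underS r k)) \<in> ordLeq"
      using ordLeq_transitive[OF _ ordLeq_transitive[OF card_of_mono1 card_of_image]] by blast
    moreover have "(card_of (underS r k), card_of K) \<in> ordLess"
      using card_of_underS[of r k] r k unfolding r_def by simp
    ultimately show False
      using not_ordLess_ordLeq by blast
  qed
  have "wf (r - Id)"
    using r(3) by (simp add: well_order_on_def)
  then have "\<exists>e. \<forall>k. k \<in> K \<longrightarrow> e k \<in> S k - e ` underS r k"
  proof (rule dependent_wf_choice[where P = "\<lambda>e k v. k \<in> K \<longrightarrow> v \<in> S k - e ` underS r k"])
    show "(k \<in> K \<longrightarrow> v \<in> S k - f ` underS r k) = (k \<in> K \<longrightarrow> v \<in> S k - g ` underS r k)"
      if "\<And>z. (z, k) \<in> r - Id \<Longrightarrow> f z = g z" for f g :: "'k \<Rightarrow> 'b" and k v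
    proof -
      have "f ` underS r k = g ` underS r k"
        using that by (intro image_cong) (auto simp: underS_def)
      then show ?thesis by simp
    qed
    show "\<exists>v. k \<in> K \<longrightarrow> v \<in> S k - f ` underS r k" for k and f :: "'k \<Rightarrow> 'b"
      using fresh[of k f] by blast
  qed
  then obtain e where e: "\<And>k. k \<in> K \<Longrightarrow> e k \<in> S k - e ` underS r k"
    by blast
  have "e k \<noteq> e l" if "k \<in> K" "l \<in> K" "k \<noteq> l" for k l
  proof -
    have "k \<in> underS r l \<or> l \<in> underS r k"
      using r(3) that unfolding well_order_on_def linear_order_on_def total_on_def underS_def
      by auto
    then show ?thesis
      using e[OF that(1)] e[OF that(2)] by (metis DiffD2 imageI)
  qed
  then have "inj_on e K"
    by (auto simp: inj_on_def)
  then show thesis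
    using that e by blast
qed

text \<open>
  Every preimage under \<open>g\<close> has the decision property of \<open>v_omega\<close>, but only below \<open>P\<close>: the map
  to be studied is meaningful on one cube only.
\<close>

definition decided_below :: "(nat \<Rightarrow> nat \<Rightarrow> bool) set \<Rightarrow> ((nat \<Rightarrow> nat \<Rightarrow> bool) \<Rightarrow> 'i) \<Rightarrow> bool" where
  "decided_below P g \<longleftrightarrow> (\<forall>J Q. silver_cube Q \<longrightarrow> Q \<subseteq> P \<longrightarrow>
     (\<exists>Q'. silver_cube Q' \<and> Q' \<subseteq> Q \<and> (g ` Q' \<subseteq> J \<or> g ` Q' \<subseteq> - J)))"

lemma decided_below_mono: "decided_below P g \<Longrightarrow> Q \<subseteq> P \<Longrightarrow> decided_below Q g"
  unfolding decided_below_def by (meson order_trans)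

text \<open>
  A choice of preimages codes the values of \<open>g\<close> by points, so each value is given by countably
  many bits. Fusion yields a cube on which every bit is decided by finitely many coordinates. If no two
  subcubes had disjoint images, then no bit could be decided differently on two pieces, and
  \<open>g\<close> would be constant.
\<close>

lemma split_or_constant:
  assumes g: "decided_below P g" and P: "silver_cube P"
    and nonconst: "\<And>Q c. silver_cube Q \<Longrightarrow> Q \<subseteq> P \<Longrightarrow> \<not> g ` Q \<subseteq> {c}"
  shows "\<exists>Q0 Q1. silver_cube Q0 \<and> silver_cube Q1 \<and> Q0 \<subseteq> P \<and> Q1 \<subseteq> P \<and> g ` Q0 \<inter> g ` Q1 = {}"
proof (rule ccontr)
  assume nosplit: "\<not> ?thesis"
  define J where "J = (\<lambda>k. {i. case prod_decode k of (m, n) \<Rightarrow> inv g i m n})"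
  obtain D x where D: "wide D" "cube D x \<subseteq> P" and
    dec: "\<And>k. \<exists>F. finite F \<and> (\<forall>y\<in>cube D x. g ` cube (D - F) y \<subseteq> J k \<or> g ` cube (D - F) y \<subseteq> - J k)"
  proof (rule fusion[of "\<lambda>k S. g ` S \<subseteq> J k \<or> g ` S \<subseteq> - J k" P])
    show "\<exists>Q'. silver_cube Q' \<and> Q' \<subseteq> Q \<and> (g ` Q' \<subseteq> J k \<or> g ` Q' \<subseteq> - J k)"
      if "silver_cube Q" "Q \<subseteq> P" for k Q
      by (rule g[unfolded decided_below_def, rule_format, OF that])
    show "g ` S \<subseteq> J k \<or> g ` S \<subseteq> - J k"
      if "g ` T \<subseteq> J k \<or> g ` T \<subseteq> - J k" "S \<subseteq> T" for k S T
      using that(1) image_mono[OF that(2), of g] by (auto dest: subset_trans)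
  qed (rule P that; assumption)+
  have same: "g y \<in> J k \<longleftrightarrow> g z \<in> J k" if yz: "y \<in> cube D x" "z \<in> cube D x" for y z k
  proof -
    obtain F where "finite F \<and>
      (\<forall>y\<in>cube D x. g ` cube (D - F) y \<subseteq> J k \<or> g ` cube (D - F) y \<subseteq> - J k)"
      using dec[of k] ..
    then have fin: "finite F" and pieces: "g ` cube (D - F) y \<subseteq> J k \<or> g ` cube (D - F) y \<subseteq> - J k"
      if "y \<in> cube D x" for y
      using that by simp_all
    have piece: "silver_cube (cube (D - F) y) \<and> cube (D - F) y \<subseteq> P" if "y \<in> cube D x" for y
      using silver_cube_cube[OF wide_diff_finite[OF D(1) fin]] cube_mono[of "D - F" D y x] that D(2)
      by auto
    have "g ` cube (D - F) y \<inter> g ` cube (D - F) z \<noteq> {}"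
      using nosplit piece[OF yz(1)] piece[OF yz(2)] by metis
    moreover have "g y \<in> g ` cube (D - F) y" "g z \<in> g ` cube (D - F) z"
      by auto
    ultimately show ?thesis
      using pieces[OF yz(1)] pieces[OF yz(2)] by blast
  qed
  have "g y = g x" if "y \<in> cube D x" for y
  proof -
    have "inv g (g y) m n = inv g (g x) m n" for m n
      using same[OF that self_in_cube, of "prod_encode (m, n)"] by (simp add: J_def)
    then have "inv g (g y) = inv g (g x)" by blast
    then show ?thesis
      by (metis f_inv_into_f rangeI)
  qed
  then have "g ` cube D x \<subseteq> {g x}" by blast
  then show False
    using nonconst[OF silver_cube_cube[OF D(1)] D(2)] by blast
qed

text \<open>
  Splitting repeatedly along the full binary tree attaches to each branch a decreasing sequence
  of cubes. These have a common point, and the values at the points of two branches differ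
  because the images became disjoint where the branches parted.
\<close>

lemma continuum_many_values:
  assumes P: "silver_cube P"
    and split: "\<And>Q. silver_cube Q \<Longrightarrow> Q \<subseteq> P \<Longrightarrow> \<exists>Q0 Q1. silver_cube Q0 \<and> silver_cube Q1 \<and>
      Q0 \<subseteq> Q \<and> Q1 \<subseteq> Q \<and> g ` Q0 \<inter> g ` Q1 = {}"
  shows "\<exists>i :: (nat \<Rightarrow> bool) \<Rightarrow> _. inj i \<and> range i \<subseteq> g ` P"
proof -
  have "\<forall>Q. \<exists>Q0 Q1. silver_cube Q \<and> Q \<subseteq> P \<longrightarrow> silver_cube Q0 \<and> silver_cube Q1 \<and>
      Q0 \<subseteq> Q \<and> Q1 \<subseteq> Q \<and> g ` Q0 \<inter> g ` Q1 = {}"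
    using split by auto
  then obtain A B where AB: "\<And>Q. silver_cube Q \<Longrightarrow> Q \<subseteq> P \<Longrightarrow> silver_cube (A Q) \<and> silver_cube (B Q) \<and>
      A Q \<subseteq> Q \<and> B Q \<subseteq> Q \<and> g ` A Q \<inter> g ` B Q = {}"
    by metis
  define L where "L = (\<lambda>b Q. if b then B Q else A Q)"
  have L: "silver_cube (L b Q)" "L b Q \<subseteq> Q" "g ` L False Q \<inter> g ` L True Q = {}"
    if "silver_cube Q" "Q \<subseteq> P" for Q b
    using AB[OF that] by (auto simp: L_def)
  define T :: "(nat \<Rightarrow> bool) \<Rightarrow> nat \<Rightarrow> _" where
    "T = (\<lambda>b. rec_nat P (\<lambda>k Q. L (b k) Q))"
  have T0: "T b 0 = P" and TS: "T b (Suc k) = L (b k) (T b k)" for b k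
    by (simp_all add: T_def)
  have T: "silver_cube (T b k) \<and> T b k \<subseteq> P" for b k
  proof (induction k)
    case (Suc k)
    then show ?case
      using L(1,2)[of "T b k" "b k"] by (auto simp: TS)
  qed (simp add: T0 P)
  have Tdec: "T b (Suc k) \<subseteq> T b k" for b k
    using L(2) T by (simp add: TS)
  have "\<exists>p. \<forall>k. p \<in> T b k" for b
  proof -
    have "\<forall>k. \<exists>D x. T b k = cube D x"
      using T unfolding silver_cube_iff by blast
    then obtain D x where Dx: "\<And>k. T b k = cube (D k) (x k)"
      by metis
    have *: "cube (D (Suc k)) (x (Suc k)) \<subseteq> cube (D k) (x k)" for k
      using Tdec[of b k] by (simp add: Dx)
    have "D (Suc k) \<subseteq> D k" "x (Suc k) \<in> cube (D k) (x k)" for k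
      using cube_subsetD[OF *] subsetD[OF * self_in_cube] by blast+
    then show ?thesis
      using nested_cubes_common_point[of D x] Dx by metis
  qed
  then obtain p where p: "\<And>b k. p b \<in> T b k"
    by metis
  have "g (p b) \<noteq> g (p b')" if "b \<noteq> b'" for b b'
  proof -
    define k where "k = (LEAST k. b k \<noteq> b' k)"
    have "\<exists>k. b k \<noteq> b' k"
      using that by blast
    then have k: "b k \<noteq> b' k"
      unfolding k_def by (rule LeastI_ex)
    have below: "b j = b' j" if "j < k" for j
      using not_less_Least[of j "\<lambda>k. b k \<noteq> b' k"] that unfolding k_def by blast
    have "T b j = T b' j" if "j \<le> k" for j
      using that by (induction j) (auto simp: T0 TS below)
    then have "p b \<in> L (b k) (T b k)" "p b' \<in> L (b' k) (T b k)"
      using p[of b "Suc k"] p[of b' "Suc k"] by (simp_all add: TS)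
    then show ?thesis
      using k L(3)[of "T b k"] T[of b k] by (cases "b k"; cases "b' k") (auto simp: disjoint_iff)
  qed
  then have "inj (\<lambda>b. g (p b))"
    by (meson injI)
  moreover have "range (\<lambda>b. g (p b)) \<subseteq> g ` P"
    using p[of _ 0] by (auto simp: T0)
  ultimately show ?thesis by blast
qed

text \<open>
  If this failed, \<open>g\<close> would have continuum many values on every subcube. As there are only continuum many
  cubes, one could pick for each cube two of its values, all of them distinct; the set of the
  first choices is a Bernstein set, whose preimage is not decided by any subcube.
\<close>

lemma constant_on_subcube:
  assumes g: "decided_below P g" and P: "silver_cube P"
  shows "\<exists>Q c. silver_cube Q \<and> Q \<subseteq> P \<and> g ` Q \<subseteq> {c}"
proof (rule ccontr)
  assume const: "\<not> ?thesis"
  define K where "K = {(D, x, b :: bool). wide D \<and> cube D x \<subseteq> P}"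
  \<comment> \<open>Codes cubes with a flag by bit sequences: there are at most continuum many of them.\<close>
  define code :: "(nat \<times> nat) set \<times> (nat \<Rightarrow> nat \<Rightarrow> bool) \<times> bool \<Rightarrow> nat \<Rightarrow> bool" where
    "code = (\<lambda>(D, x, b) j. case from_nat j of (m, n, u, v, w) \<Rightarrow>
       u = ((m, n) \<in> D) \<and> v = x m n \<and> w = b)"
  have "inj code"
  proof (rule injI)
    fix k k' assume eq: "code k = code k'"
    obtain D x b D' x' b' where k: "k = (D, x, b)" and k': "k' = (D', x', b')"
      by (metis prod_cases3)
    have "((m, n) \<in> D) = ((m, n) \<in> D') \<and> x m n = x' m n \<and> b = b'" for m n
      using fun_cong[OF eq, of "to_nat (m, n, (m, n) \<in> D, x m n, b)"]
      by (simp add: code_def k k')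
    then show "k = k'"
      unfolding k k' by auto
  qed
  have many: "\<exists>i :: (nat \<Rightarrow> bool) \<Rightarrow> _. inj i \<and> range i \<subseteq> g ` Q"
    if "silver_cube Q" "Q \<subseteq> P" for Q
  proof (rule continuum_many_values)
    fix Q' assume Q': "silver_cube Q'" "Q' \<subseteq> Q"
    show "\<exists>Q0 Q1. silver_cube Q0 \<and> silver_cube Q1 \<and> Q0 \<subseteq> Q' \<and> Q1 \<subseteq> Q' \<and> g ` Q0 \<inter> g ` Q1 = {}"
    proof (rule split_or_constant)
      show "decided_below Q' g"
        using g Q' that decided_below_mono by blast
      show "\<not> g ` Q'' \<subseteq> {c}" if "silver_cube Q''" "Q'' \<subseteq> Q'" for Q'' c
        using const Q' \<open>Q \<subseteq> P\<close> that by blast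
    qed (rule Q'(1))
  qed (rule that(1))
  obtain e where e: "inj_on e K" "\<And>k. k \<in> K \<Longrightarrow> e k \<in> (case k of (D, x, b) \<Rightarrow> g ` cube D x)"
  proof (rule injective_choice[of K "\<lambda>(D, x, b). g ` cube D x"])
    fix k assume "k \<in> K"
    then obtain D x b where k: "k = (D, x, b)" and D: "wide D" "cube D x \<subseteq> P"
      by (auto simp: K_def)
    obtain i :: "(nat \<Rightarrow> bool) \<Rightarrow> _" where i: "inj i" "range i \<subseteq> g ` cube D x"
      using many[OF silver_cube_cube[OF D(1)] D(2)] by blast
    have "inj_on (i \<circ> code) K"
      using i(1) \<open>inj code\<close> by (meson inj_compose inj_on_subset subset_UNIV)
    moreover have "(i \<circ> code) ` K \<subseteq> g ` cube D x"
      using i(2) by auto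
    ultimately show "\<exists>i. inj_on i K \<and> i ` K \<subseteq> (case k of (D, x, b) \<Rightarrow> g ` cube D x)"
      unfolding k prod.case by blast
  qed (rule that; assumption)
  define B where "B = {e (D, x, True) |D x. (D, x, True) \<in> K}"
  obtain Q where Q: "silver_cube Q" "Q \<subseteq> P" "g ` Q \<subseteq> B \<or> g ` Q \<subseteq> - B"
    using g P unfolding decided_below_def by blast
  then obtain D x where Dx: "wide D" "Q = cube D x"
    unfolding silver_cube_iff by blast
  have K: "(D, x, b) \<in> K" for b
    using Dx Q(2) by (simp add: K_def)
  have "e (D, x, False) \<notin> B"
    using e(1) K unfolding B_def inj_on_def by fastforce
  moreover have "e (D, x, True) \<in> B"
    using K by (auto simp: B_def)
  moreover have "e (D, x, b) \<in> g ` Q" for b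
    using e(2)[OF K] by (simp add: Dx)
  ultimately show False
    using Q(3) by blast
qed


section \<open>Small images and continuity\<close>

text \<open>
  A variant of the cover in M. E. Rudin's proof that metric spaces are paracompact. A point is assigned to the first centre, in a
  well-order of the space, of an \<open>\<epsilon>\<close>-ball that contains it. Of two points assigned to different
  centres, the one with the later centre lies outside the ball that the other one was assigned
  to. So if both points have room \<open>\<delta>\<close> inside the balls they were assigned to, they are at distance at
  least \<open>\<delta>\<close>, and their neighbourhoods of radius \<open>\<delta>/2\<close> are disjoint.
\<close>

lemma sigma_disjoint_open_cover:
  fixes \<epsilon> :: real
  assumes "\<epsilon> > 0"
  obtains G :: "nat \<Rightarrow> 'a::metric_space \<Rightarrow> 'a set" where
    "\<And>n a. open (G n a)" "\<And>n a b. a \<noteq> b \<Longrightarrow> G n a \<inter> G n b = {}"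
    "(\<Union>n a. G n a) = UNIV" "\<And>n a. G n a \<subseteq> ball a (2 * \<epsilon>)"
proof -
  obtain r :: "'a rel" where r: "well_order_on UNIV r"
    using well_order_on by blast
  have wf: "wf (r - Id)" and total: "\<And>a b. a \<noteq> b \<Longrightarrow> (a, b) \<in> r \<or> (b, a) \<in> r"
    using r unfolding well_order_on_def linear_order_on_def total_on_def by auto
  have "\<exists>a. dist a y < \<epsilon> \<and> (\<forall>b. dist b y < \<epsilon> \<longrightarrow> (b, a) \<notin> r - Id)" for y
  proof -
    have "y \<in> {a. dist a y < \<epsilon>}"
      using assms by simp
    from wfE_min[OF wf this] obtain a where "a \<in> {a. dist a y < \<epsilon>}"
        "\<And>b. (b, a) \<in> r - Id \<Longrightarrow> b \<notin> {a. dist a y < \<epsilon>}"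
      by metis
    then show ?thesis by auto
  qed
  then obtain c where c: "\<And>y. dist (c y) y < \<epsilon>"
      "\<And>y b. dist b y < \<epsilon> \<Longrightarrow> (b, c y) \<notin> r - Id"
    by metis
  define \<delta> where "\<delta> = (\<lambda>n. \<epsilon> / real (Suc n))"
  have \<delta>: "\<delta> n > 0" "\<delta> n \<le> \<epsilon>" for n
    using assms by (auto simp: \<delta>_def field_simps)
  define E where "E = (\<lambda>n a. {y. c y = a \<and> ball y (\<delta> n) \<subseteq> ball a \<epsilon>})"
  define G where "G = (\<lambda>n a. \<Union>y\<in>E n a. ball y (\<delta> n / 2))"
  have apart: "\<delta> n \<le> dist y z" if yz: "y \<in> E n a" "z \<in> E n b" and ab: "(a, b) \<in> r" "a \<noteq> b"
    for n a b y z
  proof (rule ccontr)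
    assume "\<not> ?thesis"
    then have "z \<in> ball y (\<delta> n)"
      by simp
    then have "dist a z < \<epsilon>"
      using yz(1) unfolding E_def by (metis (mono_tags, lifting) mem_Collect_eq mem_ball subsetD)
    then show False
      using c(2)[of a z] yz(2) ab by (auto simp: E_def)
  qed
  show thesis
  proof (rule that)
    show "open (G n a)" for n a
      by (auto simp: G_def)
    show "G n a \<inter> G n b = {}" if "a \<noteq> b" for n a b
    proof (rule ccontr)
      assume "G n a \<inter> G n b \<noteq> {}"
      then obtain u y z where u: "y \<in> E n a" "z \<in> E n b" "dist y u < \<delta> n / 2" "dist z u < \<delta> n / 2"
        by (auto simp: G_def)
      then have "dist y z < \<delta> n"
        using dist_triangle_half_l[of y u "\<delta> n" z] by simp
      then show False
        using apart u(1,2) total[OF that] that by (metis dist_commute not_less)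
    qed
    show "(\<Union>n a. G n a) = UNIV"
    proof (intro set_eqI iffI UNIV_I)
      fix y :: 'a
      define \<eta> where "\<eta> = \<epsilon> - dist (c y) y"
      have "\<eta> > 0"
        using c(1) by (simp add: \<eta>_def)
      then obtain n where n: "\<epsilon> / \<eta> < real n"
        using reals_Archimedean2 by blast
      then have "\<epsilon> < real n * \<eta>"
        using \<open>\<eta> > 0\<close> by (simp add: field_simps)
      then have "\<delta> n \<le> \<eta>"
        using \<open>\<eta> > 0\<close> unfolding \<delta>_def by (simp add: field_simps)
      have "ball y (\<delta> n) \<subseteq> ball (c y) \<epsilon>"
      proof
        fix w assume "w \<in> ball y (\<delta> n)"
        then have "dist y w < \<eta>"
          using \<open>\<delta> n \<le> \<eta>\<close> by simp
        then show "w \<in> ball (c y) \<epsilon>"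
          using dist_triangle[of "c y" w y] by (simp add: \<eta>_def)
      qed
      then have "y \<in> E n (c y)"
        by (simp add: E_def)
      then have "y \<in> G n (c y)"
        unfolding G_def using \<delta>(1)[of n] by (intro UN_I[of y]) auto
      then show "y \<in> (\<Union>n a. G n a)" by blast
    qed
    show "G n a \<subseteq> ball a (2 * \<epsilon>)" for n a
    proof
      fix u assume "u \<in> G n a"
      then obtain y where y: "c y = a" "dist y u < \<delta> n / 2"
        by (auto simp: G_def E_def)
      have "dist a u \<le> dist a y + dist y u"
        by (rule dist_triangle)
      then show "u \<in> ball a (2 * \<epsilon>)"
        using c(1)[of y] y \<delta>(2)[of n] assms by simp
    qed
  qed
qed

text \<open>
  Fusion decides the countably many layers of the cover, and within one layer the preimages of
  arbitrary unions of its members are decided, because these unions are open.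
\<close>

lemma small_image_on_subcube:
  fixes f :: "(nat \<Rightarrow> nat \<Rightarrow> bool) \<Rightarrow> 'a::metric_space"
  assumes f: "v_omega_measurable f" and "\<epsilon> > 0" and P: "silver_cube P"
  shows "\<exists>Q a. silver_cube Q \<and> Q \<subseteq> P \<and> f ` Q \<subseteq> ball a \<epsilon>"
proof -
  have decide: "\<exists>Q'. silver_cube Q' \<and> Q' \<subseteq> Q \<and> (f ` Q' \<subseteq> U \<or> f ` Q' \<subseteq> - U)"
    if U: "open U" and Q: "silver_cube Q" for U Q
  proof -
    have "f -` U \<in> v_omega"
      using f U by (simp add: v_omega_measurable_def)
    then obtain Q' where "silver_cube Q'" "Q' \<subseteq> Q" "Q' \<subseteq> f -` U \<or> Q' \<subseteq> - (f -` U)"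
      using Q unfolding v_omega_def by blast
    then show ?thesis by blast
  qed
  obtain G :: "nat \<Rightarrow> 'a \<Rightarrow> 'a set" where
    G: "\<And>n a. open (G n a)" "\<And>n a b. a \<noteq> b \<Longrightarrow> G n a \<inter> G n b = {}"
      "(\<Union>n a. G n a) = UNIV" "\<And>n a. G n a \<subseteq> ball a (2 * (\<epsilon> / 2))"
    using sigma_disjoint_open_cover[of "\<epsilon> / 2"] \<open>\<epsilon> > 0\<close> by (metis half_gt_zero)
  define W where "W = (\<lambda>n. \<Union>a. G n a)"
  have open_W: "open (W n)" for n
    using G(1) unfolding W_def by blast
  \<comment> \<open>Some layer of the cover contains the image of a subcube.\<close>
  obtain D x where D: "wide D" "cube D x \<subseteq> P" and
    dec: "\<And>n. \<exists>F. finite F \<and> (\<forall>y\<in>cube D x. f ` cube (D - F) y \<subseteq> W n \<or> f ` cube (D - F) y \<subseteq> - W n)"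
  proof (rule fusion[of "\<lambda>n S. f ` S \<subseteq> W n \<or> f ` S \<subseteq> - W n" P])
    show "\<exists>Q'. silver_cube Q' \<and> Q' \<subseteq> Q \<and> (f ` Q' \<subseteq> W n \<or> f ` Q' \<subseteq> - W n)"
      if "silver_cube Q" for n Q
      using open_W that by (rule decide)
    show "f ` S \<subseteq> W n \<or> f ` S \<subseteq> - W n"
      if "f ` T \<subseteq> W n \<or> f ` T \<subseteq> - W n" "S \<subseteq> T" for n S T
      using that(1) image_mono[OF that(2), of f] by (auto dest: subset_trans)
  qed (rule P that; assumption)+
  obtain n where n: "f x \<in> W n"
    using G(3) unfolding W_def by blast
  obtain F where "finite F \<and>
      (\<forall>y\<in>cube D x. f ` cube (D - F) y \<subseteq> W n \<or> f ` cube (D - F) y \<subseteq> - W n)"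
    using dec[of n] ..
  then have F: "finite F" "f ` cube (D - F) x \<subseteq> W n \<or> f ` cube (D - F) x \<subseteq> - W n"
    using self_in_cube by simp_all
  define P' where "P' = cube (D - F) x"
  have P': "silver_cube P'" "P' \<subseteq> P"
    using silver_cube_cube[OF wide_diff_finite[OF D(1) F(1)]] cube_mono[of "D - F" D x x] D(2)
    unfolding P'_def by auto
  have "f x \<in> f ` P'"
    by (simp add: P'_def)
  then have P'W: "f ` P' \<subseteq> W n"
    using F(2) n unfolding P'_def by blast
  \<comment> \<open>By disjointness of the layer this is the only member that contains \<open>f y\<close>.\<close>
  define g where "g = (\<lambda>y. SOME a. f y \<in> G n a)"
  have gG: "f y \<in> G n (g y)" if "y \<in> P'" for y
  proof -
    have "f y \<in> W n"
      using P'W that by blast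
    then have "\<exists>a. f y \<in> G n a"
      by (simp add: W_def)
    then show ?thesis
      unfolding g_def by (rule someI_ex)
  qed
  have "decided_below P' g"
    unfolding decided_below_def
  proof (intro allI impI)
    fix J Q assume Q: "silver_cube Q" "Q \<subseteq> P'"
    have "open (\<Union>a\<in>J. G n a)"
      using G(1) by blast
    from decide[OF this Q(1)] obtain Q' where Q': "silver_cube Q'" "Q' \<subseteq> Q"
        "f ` Q' \<subseteq> (\<Union>a\<in>J. G n a) \<or> f ` Q' \<subseteq> - (\<Union>a\<in>J. G n a)"
      by metis
    have "f y \<in> (\<Union>a\<in>J. G n a) \<longleftrightarrow> g y \<in> J" if "y \<in> Q'" for y
    proof -
      have y: "f y \<in> G n (g y)"
        using gG that Q'(2) Q(2) by (meson subsetD)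
      then have "a = g y" if "f y \<in> G n a" for a
        using G(2)[of a "g y" n] that by (meson disjoint_iff)
      then show ?thesis
        using y by (metis UN_iff)
    qed
    then have "g ` Q' \<subseteq> J \<or> g ` Q' \<subseteq> - J"
      using Q'(3) by (simp add: image_subset_iff) blast
    then show "\<exists>Q'. silver_cube Q' \<and> Q' \<subseteq> Q \<and> (g ` Q' \<subseteq> J \<or> g ` Q' \<subseteq> - J)"
      using Q'(1,2) by metis
  qed
  from constant_on_subcube[OF this P'(1)]
  obtain Q a where Q: "silver_cube Q" "Q \<subseteq> P'" "g ` Q \<subseteq> {a}"
    by metis
  then have "f ` Q \<subseteq> G n a"
    using gG by blast
  then have "f ` Q \<subseteq> ball a \<epsilon>"
    using G(4)[of n a] by simp
  then show ?thesis
    using Q P'(2) by blast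
qed

lemma open_agree_on_finite:
  fixes y :: "nat \<Rightarrow> nat \<Rightarrow> bool"
  assumes "finite F"
  shows "open {z. \<forall>(m, n)\<in>F. z m n = y m n}"
proof -
  have "open {z :: nat \<Rightarrow> nat \<Rightarrow> bool. z m n = y m n}" for m n
  proof -
    have "continuous_on UNIV (\<lambda>z :: nat \<Rightarrow> nat \<Rightarrow> bool. z m n)"
      by (rule continuous_on_compose2[OF continuous_on_product_coordinates[of n]
            continuous_on_product_coordinates[of m]]) simp
    then have "open ((\<lambda>z :: nat \<Rightarrow> nat \<Rightarrow> bool. z m n) -` {y m n})"
      by (intro open_vimage open_discrete)
    then show ?thesis
      by (simp add: vimage_def)
  qed
  then have "open (\<Inter>(m, n)\<in>F. {z :: nat \<Rightarrow> nat \<Rightarrow> bool. z m n = y m n})"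
    using assms by (intro open_INT) auto
  moreover have "(\<Inter>(m, n)\<in>F. {z :: nat \<Rightarrow> nat \<Rightarrow> bool. z m n = y m n}) =
      {z. \<forall>(m, n)\<in>F. z m n = y m n}"
    by auto
  ultimately show ?thesis by simp
qed

theorem theorem8:
  fixes f :: "nat \<Rightarrow> (nat \<Rightarrow> nat \<Rightarrow> bool) \<Rightarrow> 'a::metric_space"
  assumes "\<And>n. v_omega_measurable (f n)"
  shows "\<exists>Q. silver_cube Q \<and> (\<forall>n. continuous_on Q (f n))"
proof -
  \<comment> \<open>Each \<open>k\<close> codes a pair of a function and a precision.\<close>
  define small where "small = (\<lambda>k S. case prod_decode k of (n, j) \<Rightarrow>
    \<exists>a. f n ` S \<subseteq> ball a (1 / real (Suc j)))"
  have "wide UNIV"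
    by (simp add: wide_def)
  obtain D x where D: "wide D" and
    small: "\<And>k. \<exists>F. finite F \<and> (\<forall>y\<in>cube D x. small k (cube (D - F) y))"
  proof (rule fusion[of small "cube UNIV (\<lambda>_ _. True)"])
    show "small k S" if "small k T" "S \<subseteq> T" for k S T
      using that unfolding small_def by (auto split: prod.splits)
    show "\<exists>Q'. silver_cube Q' \<and> Q' \<subseteq> Q \<and> small k Q'" if "silver_cube Q" for k Q
    proof -
      obtain n j where k: "prod_decode k = (n, j)" by fastforce
      show ?thesis
        using small_image_on_subcube[OF assms[of n] _ that, of "1 / real (Suc j)"]
        by (auto simp: small_def k)
    qed
    show "silver_cube (cube UNIV (\<lambda>_ _. True))"
      using \<open>wide UNIV\<close> by (rule silver_cube_cube)
  qed (rule that; assumption)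
  have "continuous_on (cube D x) (f n)" for n
    unfolding continuous_on_def
  proof (intro ballI tendstoI)
    fix y :: "nat \<Rightarrow> nat \<Rightarrow> bool" and e :: real
    assume y: "y \<in> cube D x" and "e > 0"
    then obtain j where j: "1 / real (Suc j) < e / 2"
      using nat_approx_posE[of "e / 2"] by (metis half_gt_zero)
    obtain F a where F: "finite F" and a: "f n ` cube (D - F) y \<subseteq> ball a (1 / real (Suc j))"
      using small[of "prod_encode (n, j)"] y by (auto simp: small_def)
    have "dist (f n z) (f n y) < e"
      if z: "z \<in> cube D x" and agree: "\<forall>(m, n)\<in>F. z m n = y m n" for z
    proof -
      have "z \<in> cube (D - F) y"
        using z y agree by (auto simp: cube_def)
      then have "f n z \<in> ball a (e / 2)" "f n y \<in> ball a (e / 2)"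
        using a j self_in_cube[of y "D - F"] by fastforce+
      then show ?thesis
        using dist_triangle_half_r[of a "f n z" e "f n y"] by simp
    qed
    then show "\<forall>\<^sub>F z in at y within cube D x. dist (f n z) (f n y) < e"
      unfolding eventually_at_topological
      by (intro exI[of _ "{z. \<forall>(m, n)\<in>F. z m n = y m n}"])
        (use open_agree_on_finite[OF F, of y] in auto)
  qed
  then show ?thesis
    using silver_cube_cube[OF D] by blast
qed

end
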